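(* Let $n\ge 1$ and $N\ge 2$ be integers, let $\nu_1,\dots,\nu_N\in\mathbb R$ be pairwise distinct, and suppose that $$0\le \kappa<\kappa_{\mathrm{inc}}:=\frac{\min_{k\ne l}|\nu_k-\nu_l|}{2^{n+1}a_n}.$$ Let $\Theta=(\theta_1,\dots,\theta_N)$ be a global solution (on $[0,\infty)$) of the Winfree model of order $n$ with natural frequencies $\nu_1,\dots,\nu_N$ and coupling strength $\kappa$. Then for all indices $i,j$ with $\nu_i>\nu_j$, $$\inf_{0\le t<\infty}|\dot\theta_i(t)-\dot\theta_j(t)|\ \ge\ \omega_{ij}^\infty:=|\nu_i-\nu_j|-\kappa 2^{n+1}a_n\ >0 .$$
   Context: For an integer $n\ge1$ put $a_n=\frac{(2n)!!}{2^n(2n-1)!!}$, $I_n(\theta)=a_n(1+\cos\theta)^n=2^na_n\cos^{2n}\frac{\theta}{2}$ and $S(\theta)=-\sin\theta$. The Winfree model of order $n$ with natural frequencies $\nu_1,\dots,\nu_N\in\mathbb R$ and coupling strength $\kappa$ is the ODE system on $\mathbb R^N$ $$\dot\theta_i=\nu_i+\frac{\kappa}{N}\sum_{j=1}^N I_n(\theta_j)S(\theta_i),\qquad i=1,\dots,N.$$ *)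

theory Defs
  imports "HOL-Analysis.Analysis"
begin

fun double_fact :: "nat \<Rightarrow> nat" where
  "double_fact 0 = 1"
| "double_fact (Suc 0) = 1"
| "double_fact (Suc (Suc n)) = Suc (Suc n) * double_fact n"

text \<open>The order \<open>n\<close> is meant to satisfy \<open>n \<ge> 1\<close>, so that \<open>2 * n - 1\<close> is not truncated.\<close>

definition winfree_a :: "nat \<Rightarrow> real" where
  "winfree_a n = real (double_fact (2 * n)) / (2 ^ n * real (double_fact (2 * n - 1)))"

definition winfree_I :: "nat \<Rightarrow> real \<Rightarrow> real" where
  "winfree_I n \<theta> = winfree_a n * (1 + cos \<theta>) ^ n"

definition winfree_S :: "real \<Rightarrow> real" where
  "winfree_S \<theta> = - sin \<theta>"

text \<open>The number \<open>N\<close> of oscillators is \<open>CARD('N)\<close>.\<close>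

definition winfree_field :: "nat \<Rightarrow> real ^ 'N \<Rightarrow> real \<Rightarrow> real ^ 'N \<Rightarrow> real ^ 'N" where
  "winfree_field n \<nu> \<kappa> \<theta> =
     (\<chi> i. \<nu> $ i + \<kappa> / real CARD('N) * (\<Sum>j\<in>UNIV. winfree_I n (\<theta> $ j) * winfree_S (\<theta> $ i)))"

text \<open>At \<open>t = 0\<close> the derivative is the one-sided one; values of \<open>\<Theta>\<close> at negative times are
  irrelevant.\<close>

definition winfree_global_solution ::
    "nat \<Rightarrow> real ^ 'N \<Rightarrow> real \<Rightarrow> (real \<Rightarrow> real ^ 'N) \<Rightarrow> bool" where
  "winfree_global_solution n \<nu> \<kappa> \<Theta> \<longleftrightarrow>
     (\<forall>t\<ge>0. (\<Theta> has_vector_derivative winfree_field n \<nu> \<kappa> (\<Theta> t)) (at t within {0..}))"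

text \<open>For \<open>CARD('N) \<ge> 2\<close> the set under \<open>Min\<close> is finite and nonempty.\<close>

definition winfree_kappa_inc :: "nat \<Rightarrow> real ^ 'N \<Rightarrow> real" where
  "winfree_kappa_inc n \<nu> =
     Min {\<bar>\<nu> $ k - \<nu> $ l\<bar> | k l. k \<noteq> l} / (2 ^ (n + 1) * winfree_a n)"

definition winfree_omega_inf :: "nat \<Rightarrow> real ^ 'N \<Rightarrow> real \<Rightarrow> 'N \<Rightarrow> 'N \<Rightarrow> real" where
  "winfree_omega_inf n \<nu> \<kappa> i j = \<bar>\<nu> $ i - \<nu> $ j\<bar> - \<kappa> * 2 ^ (n + 1) * winfree_a n"

end

theory Submission
  imports Defs
begin

text \<open>All oscillators feel the same mean influence \<open>A\<close>, the average of
  \<open>winfree_I n\<close> over the phases, so velocities differ by \<nu>_i - \<nu>_j + \<kappa> A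
  (S(\<theta>_i) - S(\<theta>_j)). Since 0 \<le> A \<le> 2^n a_n and two values of S differ by at
  most 2, the coupling changes the frequency gap by at most \<kappa> 2^(n+1) a_n. This estimate
  (\<open>winfree_field_diff_ge\<close>) holds at every phase configuration, hence along the whole
  trajectory and for the infimum over time.\<close>

lemma double_fact_pos: "double_fact n > 0"
  by (induction n rule: double_fact.induct) auto

lemma winfree_a_pos: "winfree_a n > 0"
  by (simp add: winfree_a_def double_fact_pos)

lemma winfree_I_nonneg: "0 \<le> winfree_I n x"
proof -
  have "0 \<le> 1 + cos x"
    using cos_ge_minus_one[of x] by linarith
  then show ?thesis
    unfolding winfree_I_def using winfree_a_pos[of n] by simp
qed

lemma winfree_I_le: "winfree_I n x \<le> 2 ^ n * winfree_a n"
proof -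
  have "0 \<le> 1 + cos x" "1 + cos x \<le> 2"
    using cos_ge_minus_one[of x] cos_le_one[of x] by linarith+
  then have "(1 + cos x) ^ n \<le> 2 ^ n"
    by (intro power_mono)
  then show ?thesis
    unfolding winfree_I_def using winfree_a_pos[of n] by (simp add: mult.commute)
qed

lemma abs_winfree_S_diff_le: "\<bar>winfree_S x - winfree_S y\<bar> \<le> 2"
  unfolding winfree_S_def
  using sin_le_one[of x] sin_le_one[of y] sin_ge_minus_one[of x] sin_ge_minus_one[of y]
  by linarith

lemma winfree_field_diff_ge:
  fixes \<nu> \<theta> :: "real ^ 'N"
  assumes "0 \<le> \<kappa>"
  shows "winfree_omega_inf n \<nu> \<kappa> i j
    \<le> \<bar>winfree_field n \<nu> \<kappa> \<theta> $ i - winfree_field n \<nu> \<kappa> \<theta> $ j\<bar>"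
proof -
  define A where "A = (\<Sum>k\<in>UNIV. winfree_I n (\<theta> $ k)) / real CARD('N)"
  define s where "s = winfree_S (\<theta> $ i) - winfree_S (\<theta> $ j)"
  have "0 \<le> A"
    unfolding A_def by (simp add: sum_nonneg winfree_I_nonneg)
  have "(\<Sum>k\<in>UNIV. winfree_I n (\<theta> $ k)) \<le> real CARD('N) * (2 ^ n * winfree_a n)"
    by (intro sum_bounded_above winfree_I_le)
  then have "A \<le> 2 ^ n * winfree_a n"
    unfolding A_def by (simp add: divide_simps mult_ac)
  \<comment> \<open>The factor 2 bounding \<open>\<bar>s\<bar>\<close> turns 2^n into the 2^(n+1) of
    \<open>winfree_omega_inf\<close>.\<close>
  have "\<kappa> * (A * \<bar>s\<bar>) \<le> \<kappa> * ((2 ^ n * winfree_a n) * 2)"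
    using \<open>0 \<le> A\<close> \<open>A \<le> _\<close> assms abs_winfree_S_diff_le[of "\<theta> $ i" "\<theta> $ j"]
    unfolding s_def by (intro mult_left_mono mult_mono) auto
  then have "\<bar>\<kappa> * A * s\<bar> \<le> \<kappa> * 2 ^ (n + 1) * winfree_a n"
    using assms \<open>0 \<le> A\<close> by (simp add: abs_mult mult_ac)
  \<comment> \<open>The factor \<open>winfree_S\<close> does not depend on the summation index;
    pulling it out leaves the same \<open>A\<close> in both components.\<close>
  moreover have "winfree_field n \<nu> \<kappa> \<theta> $ i - winfree_field n \<nu> \<kappa> \<theta> $ j
      = \<nu> $ i - \<nu> $ j + \<kappa> * A * s"
    unfolding winfree_field_def A_def s_def sum_distrib_right[symmetric]
    by (simp add: algebra_simps diff_divide_distrib)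
  ultimately show ?thesis
    unfolding winfree_omega_inf_def by linarith
qed

text \<open>The threshold is the smallest frequency gap divided by exactly the constant that
  multiplies \<kappa> in the loss, so below it the loss is less than every gap.\<close>

lemma winfree_omega_inf_pos:
  fixes \<nu> :: "real ^ 'N"
  assumes "\<kappa> < winfree_kappa_inc n \<nu>" and "i \<noteq> j"
  shows "0 < winfree_omega_inf n \<nu> \<kappa> i j"
proof -
  let ?D = "{\<bar>\<nu> $ k - \<nu> $ l\<bar> | k l. k \<noteq> l}"
  have "?D \<subseteq> (\<lambda>(k, l). \<bar>\<nu> $ k - \<nu> $ l\<bar>) ` UNIV"
    by auto
  then have "finite ?D"
    by (rule finite_subset) simp
  then have "Min ?D \<le> \<bar>\<nu> $ i - \<nu> $ j\<bar>"
    using assms(2) by (intro Min_le) auto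
  moreover have "\<kappa> * (2 ^ (n + 1) * winfree_a n) < Min ?D"
    using assms(1) winfree_a_pos[of n]
    unfolding winfree_kappa_inc_def by (simp add: pos_less_divide_eq)
  ultimately show ?thesis
    unfolding winfree_omega_inf_def by (simp add: mult.assoc)
qed

text \<open>\<open>vector_derivative\<close> is defined by choice, so identifying it with the field
  needs uniqueness of the derivative, that is, a nontrivial filter at each time, including the
  endpoint 0.\<close>

lemma winfree_global_solution_vector_derivative:
  assumes "winfree_global_solution n \<nu> \<kappa> \<Theta>" and "0 \<le> t"
  shows "vector_derivative \<Theta> (at t within {0..}) = winfree_field n \<nu> \<kappa> (\<Theta> t)"
proof (rule vector_derivative_within)
  have "{0::real..} \<noteq> {x}" for x
    using infinite_Ici[of "0::real"] by (metis finite.emptyI finite.insertI)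
  \<comment> \<open>A connected set that is not a singleton has no isolated points.\<close>
  then have "t islimpt {0::real..}"
    using assms(2) by (intro connected_imp_perfect) auto
  then show "at t within {0..} \<noteq> bot"
    by (simp add: trivial_limit_within)
  show "(\<Theta> has_vector_derivative winfree_field n \<nu> \<kappa> (\<Theta> t)) (at t within {0..})"
    using assms unfolding winfree_global_solution_def by blast
qed

theorem theorem3p1:
  fixes n :: nat and \<nu> :: "real ^ 'N" and \<kappa> :: real and \<Theta> :: "real \<Rightarrow> real ^ 'N"
  assumes "n \<ge> 1"
    and "CARD('N) \<ge> 2"
    and "\<And>k l. k \<noteq> l \<Longrightarrow> \<nu> $ k \<noteq> \<nu> $ l"
    and "0 \<le> \<kappa>" and "\<kappa> < winfree_kappa_inc n \<nu>"
    and "winfree_global_solution n \<nu> \<kappa> \<Theta>"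
  shows "\<forall>i j. \<nu> $ i > \<nu> $ j \<longrightarrow>
    (INF t\<in>{0..}. \<bar>vector_derivative \<Theta> (at t within {0..}) $ i
                   - vector_derivative \<Theta> (at t within {0..}) $ j\<bar>)
      \<ge> winfree_omega_inf n \<nu> \<kappa> i j
    \<and> winfree_omega_inf n \<nu> \<kappa> i j > 0"
proof (intro allI impI conjI)
  fix i j
  assume "\<nu> $ i > \<nu> $ j"
  then show "winfree_omega_inf n \<nu> \<kappa> i j > 0"
    using assms(5) by (intro winfree_omega_inf_pos) auto
  show "(INF t\<in>{0..}. \<bar>vector_derivative \<Theta> (at t within {0..}) $ i
                   - vector_derivative \<Theta> (at t within {0..}) $ j\<bar>)
      \<ge> winfree_omega_inf n \<nu> \<kappa> i j"
    \<comment> \<open>A uniform pointwise lower bound passes to the infimum over the nonempty set of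
      times.\<close>
    using assms(4,6)
    by (intro cINF_greatest)
      (auto simp: winfree_global_solution_vector_derivative winfree_field_diff_ge)
qed

end
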